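(* Let $\gamma\in[0,1]$, $x\in\mathcal{X}$, and let $C_\gamma(x)$ be the $\gamma$-relative surprise region for $\tau=\Upsilon(\theta)$. Then $C_\gamma(x)$ has maximal Bayes factor and maximal relative belief ratio among all measurable sets $C\subset\mathcal{T}$ satisfying $\Pi_\Upsilon(C\mid x)=\Pi_\Upsilon(C_\gamma(x)\mid x)$; that is, $BF_C(x)\le BF_{C_\gamma(x)}(x)$ and $RB_C(x)\le RB_{C_\gamma(x)}(x)$ for every such $C$.
   Context: Setting: $\{f_\theta:\theta\in\Theta\}$ is a statistical model, $f_\theta$ being the density of a probability measure $P_\theta$ with respect to a support measure $\mu$ on the sample space $\mathcal{X}$. $\Pi$ is a proper prior (a probability measure) on $\Theta$. The joint distribution of $(\theta,X)$ is $\theta\sim\Pi$, $X\mid\theta\sim P_\theta$. The parameter of interest is $\tau=\Upsilon(\theta)\in\mathcal{T}$; $\Pi_\Upsilon$ and $\Pi_\Upsilon(\cdot\mid x)$ are its marginal prior and posterior (given $X=x$) distributions, with densities $\pi_\Upsilon$ and $\pi_\Upsilon(\cdot\mid x)$ with respect to a support measure $\nu_{\mathcal{T}}$ on $\mathcal{T}$. It is assumed that $\pi_\Upsilon(\tau)>0$ for every $\tau\in\mathcal{T}$. The $\gamma$-relative surprise region is $$C_\gamma(x)=\left\{\tau_0\in\mathcal{T}:\Pi_\Upsilon\left(\left\{\tau:\frac{\pi_\Upsilon(\tau\mid x)}{\pi_\Upsilon(\tau)}>\frac{\pi_\Upsilon(\tau_0\mid x)}{\pi_\Upsilon(\tau_0)}\right\}\,\Big|\,x\right)\le\gamma\right\}.$$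 For measurable $C\subset\mathcal{T}$ the Bayes factor in favor of $C$ and the relative belief ratio of $C$ are $$BF_C(x)=\frac{\Pi_\Upsilon(C\mid x)/(1-\Pi_\Upsilon(C\mid x))}{\Pi_\Upsilon(C)/(1-\Pi_\Upsilon(C))},\qquad RB_C(x)=\frac{\Pi_\Upsilon(C\mid x)}{\Pi_\Upsilon(C)}.$$ The comparisons concern sets for which these quantities are defined: $0<\Pi_\Upsilon(C)<1$ for $BF_C(x)$ (with $BF_C(x)=+\infty$ if $\Pi_\Upsilon(C\mid x)=1$), and $\Pi_\Upsilon(C)>0$ for $RB_C(x)$, both for the competitors $C$ and for $C_\gamma(x)$.
   Formalization: For γ = 1 the relative belief ratio claim is stated only when the posterior density of τ is positive for almost every τ under the marginal prior; otherwise it is false, since C_1(x) is all of 𝒯 and the set where the posterior density is positive has a larger ratio. *)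

theory Defs
  imports "HOL-Probability.Probability"
begin

definition sampling_dist :: "'x measure \<Rightarrow> ('t \<Rightarrow> 'x \<Rightarrow> real) \<Rightarrow> 't \<Rightarrow> 'x measure" where
  "sampling_dist \<mu> f \<theta> = density \<mu> (\<lambda>x. ennreal (f \<theta> x))"

definition joint_dist ::
  "'t measure \<Rightarrow> 'x measure \<Rightarrow> ('t \<Rightarrow> 'x \<Rightarrow> real) \<Rightarrow> ('t \<times> 'x) measure" where
  "joint_dist prior \<mu> f =
     prior \<bind> (\<lambda>\<theta>. sampling_dist \<mu> f \<theta> \<bind> (\<lambda>x. return (prior \<Otimes>\<^sub>M \<mu>) (\<theta>, x)))"

definition predictive_dist :: "'t measure \<Rightarrow> 'x measure \<Rightarrow> ('t \<Rightarrow> 'x \<Rightarrow> real) \<Rightarrow> 'x measure" where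
  "predictive_dist prior \<mu> f = distr (joint_dist prior \<mu> f) \<mu> snd"

text \<open>
  A posterior is any version of the regular conditional distribution of the parameter given the
  observation: a Markov kernel that, together with the law of the observation, recovers the joint
  law. The Bayes formula gives such a version wherever its normalising constant is positive and
  finite, and the kernel is defined at every point of the sample space.
\<close>

definition is_posterior ::
  "'t measure \<Rightarrow> 'x measure \<Rightarrow> ('t \<Rightarrow> 'x \<Rightarrow> real) \<Rightarrow> ('x \<Rightarrow> 't measure) \<Rightarrow> bool" where
  "is_posterior prior \<mu> f post \<longleftrightarrow>
     post \<in> \<mu> \<rightarrow>\<^sub>M prob_algebra prior \<and>
     joint_dist prior \<mu> f =
       predictive_dist prior \<mu> f \<bind> (\<lambda>x. post x \<bind> (\<lambda>\<theta>. return (prior \<Otimes>\<^sub>M \<mu>) (\<theta>, x)))"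

text \<open>
  The parameter space, the sample space and the space of the parameter of interest are the
  underlying measurable spaces of \<open>prior\<close>, \<open>\<mu>\<close> and \<open>\<nu>\<close>. Measurability of the map from
  parameters to sampling distributions is what makes the joint law of parameter and observation
  well defined. The functions \<open>d\<close> and \<open>dpost x\<close> are arbitrary versions of the
  marginal prior and posterior densities.
\<close>

locale bayesian_model =
  fixes prior :: "'t measure"
    and \<mu> :: "'x measure"
    and f :: "'t \<Rightarrow> 'x \<Rightarrow> real"
    and post :: "'x \<Rightarrow> 't measure"
    and \<nu> :: "'p measure"
    and \<Upsilon> :: "'t \<Rightarrow> 'p"
    and d :: "'p \<Rightarrow> real"
    and dpost :: "'x \<Rightarrow> 'p \<Rightarrow> real"
  assumes prior_prob: "prob_space prior"
    and f_measurable: "\<And>\<theta>. \<theta> \<in> space prior \<Longrightarrow> f \<theta> \<in> borel_measurable \<mu>"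
    and f_nonneg: "\<And>\<theta> x. \<theta> \<in> space prior \<Longrightarrow> x \<in> space \<mu> \<Longrightarrow> 0 \<le> f \<theta> x"
    and sampling_kernel: "sampling_dist \<mu> f \<in> prior \<rightarrow>\<^sub>M prob_algebra \<mu>"
    and posterior: "is_posterior prior \<mu> f post"
    and \<Upsilon>_measurable: "\<Upsilon> \<in> prior \<rightarrow>\<^sub>M \<nu>"
    and d_measurable: "d \<in> borel_measurable \<nu>"
    and d_pos: "\<And>\<tau>. \<tau> \<in> space \<nu> \<Longrightarrow> 0 < d \<tau>"
    and d_density: "distr prior \<nu> \<Upsilon> = density \<nu> (\<lambda>\<tau>. ennreal (d \<tau>))"
    and dpost_measurable: "\<And>x. x \<in> space \<mu> \<Longrightarrow> dpost x \<in> borel_measurable \<nu>"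
    and dpost_nonneg: "\<And>x \<tau>. x \<in> space \<mu> \<Longrightarrow> \<tau> \<in> space \<nu> \<Longrightarrow> 0 \<le> dpost x \<tau>"
    and dpost_density: "\<And>x. x \<in> space \<mu> \<Longrightarrow>
          distr (post x) \<nu> \<Upsilon> = density \<nu> (\<lambda>\<tau>. ennreal (dpost x \<tau>))"

text \<open>
  In the following, \<open>P\<close> and \<open>Q\<close> stand for the marginal prior and the marginal posterior of the
  parameter of interest, with densities \<open>p\<close> and \<open>q\<close>.
\<close>

definition relative_surprise_region ::
  "'p measure \<Rightarrow> ('p \<Rightarrow> real) \<Rightarrow> ('p \<Rightarrow> real) \<Rightarrow> real \<Rightarrow> 'p set" where
  "relative_surprise_region Q p q \<gamma> =
     {\<tau>0 \<in> space Q. measure Q {\<tau> \<in> space Q. q \<tau> / p \<tau> > q \<tau>0 / p \<tau>0} \<le> \<gamma>}"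

text \<open>The value is only meaningful for \<open>0 < measure P C < 1\<close>.\<close>

definition bayes_factor :: "'p measure \<Rightarrow> 'p measure \<Rightarrow> 'p set \<Rightarrow> ereal" where
  "bayes_factor P Q C =
     (if measure Q C = 1 then \<infinity>
      else ereal ((measure Q C / (1 - measure Q C)) / (measure P C / (1 - measure P C))))"

text \<open>
  The value is only meaningful for \<open>0 < measure P C\<close>. For \<open>\<gamma> = 1\<close> the relative surprise region
  is the whole space, with ratio 1; if \<open>q\<close> vanishes on a set of positive \<open>P\<close>-measure, then
  \<open>{\<tau>. 0 < q \<tau>}\<close> has the same posterior content and a larger ratio. Maximality of the ratio at
  \<open>\<gamma> = 1\<close> therefore holds precisely when \<open>q\<close> is positive \<open>P\<close>-almost everywhere.
\<close>

definition relative_belief_ratio :: "'p measure \<Rightarrow> 'p measure \<Rightarrow> 'p set \<Rightarrow> real" where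
  "relative_belief_ratio P Q C = measure Q C / measure P C"

end

theory Submission imports Defs begin

text \<open>
  With \<open>h\<close> the ratio of posterior to prior density, the marginal posterior has density \<open>h\<close> with
  respect to the marginal prior \<open>P\<close>, and the region \<open>R\<close> is an upper level set of \<open>h\<close>: there is
  a threshold \<open>k\<close> with \<open>h \<ge> k\<close> on \<open>R\<close> and \<open>h \<le> k\<close> off \<open>R\<close>. If \<open>C\<close> has the same posterior
  content as \<open>R\<close>, then so have \<open>C - R\<close> and \<open>R - C\<close>, and the Neyman-Pearson comparison
  \<open>k P(R - C) \<le> Q(R - C) = Q(C - R) \<le> k P(C - R)\<close> gives \<open>P(R) \<le> P(C)\<close>. For \<open>k = 0\<close> the
  comparison still works provided that \<open>h\<close> is positive almost everywhere on \<open>R\<close>; when it fails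
  to be positive, \<open>R\<close> has full posterior content.
\<close>

lemma measure_le_of_density_upper_set:
  fixes h :: "'a \<Rightarrow> real"
  assumes fin: "finite_measure P"
    and hm: "h \<in> borel_measurable P"
    and h0: "\<And>x. x \<in> space P \<Longrightarrow> 0 \<le> h x"
    and Q: "Q = density P (\<lambda>x. ennreal (h x))"
    and finQ: "finite_measure Q"
    and R: "R \<in> sets P" and C: "C \<in> sets P"
    and upper: "\<And>a b. a \<in> R \<Longrightarrow> b \<in> space P - R \<Longrightarrow> h b \<le> h a"
    and pos: "AE x in P. x \<in> R \<longrightarrow> 0 < h x"
    and eq: "measure Q C = measure Q R"
  shows "measure P R \<le> measure P C"
proof (cases "R = {}")
  case True
  then show ?thesis by simp
next
  case False
  interpret P: finite_measure P by fact
  interpret Q: finite_measure Q by fact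
  have sQ: "sets Q = sets P" by (simp add: Q)
  have RP: "R \<subseteq> space P" and CP: "C \<subseteq> space P"
    using R C sets.sets_into_space by auto
  define k where "k = Inf (h ` R)"
  have bdd: "bdd_below (h ` R)" using h0 RP by (auto intro!: bdd_belowI[of _ 0])
  have kR: "k \<le> h a" if "a \<in> R" for a
    unfolding k_def using bdd that by (auto intro: cInf_lower)
  have kN: "h b \<le> k" if "b \<in> space P - R" for b
    unfolding k_def using False upper that by (auto intro!: cInf_greatest)
  have k0: "0 \<le> k"
    unfolding k_def using False h0 RP by (auto intro!: cInf_greatest)
  have split: "measure M A = measure M (A - B) + measure M (A \<inter> B)"
    if "finite_measure M" "A \<in> sets M" "B \<in> sets M" for M :: "'a measure" and A B
  proof -
    interpret finite_measure M by fact
    have "measure M (A - B) + measure M (A \<inter> B) = measure M ((A - B) \<union> (A \<inter> B))"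
      using that by (intro finite_measure_Union[symmetric]) auto
    then show ?thesis by (simp add: Un_Diff_Int)
  qed
  have Qeq: "measure Q (C - R) = measure Q (R - C)"
    using split[OF finQ, of R C] split[OF finQ, of C R] eq R C sQ by (simp add: Int_commute)
  have emQ: "emeasure Q A = (\<integral>\<^sup>+x. ennreal (h x) * indicator A x \<partial>P)" if "A \<in> sets P" for A
    unfolding Q using that hm by (intro emeasure_density) auto
  have const: "(\<integral>\<^sup>+x. ennreal k * indicator A x \<partial>P) = ennreal (k * measure P A)"
    if "A \<in> sets P" for A
    using that k0 by (simp add: nn_integral_cmult_indicator P.emeasure_eq_measure ennreal_mult')
  have up: "measure Q (C - R) \<le> k * measure P (C - R)"
  proof -
    have "emeasure Q (C - R) \<le> (\<integral>\<^sup>+x. ennreal k * indicator (C - R) x \<partial>P)"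
      unfolding emQ[OF sets.Diff[OF C R]] using kN CP
      by (intro nn_integral_mono) (auto split: split_indicator intro!: ennreal_leI)
    also have "\<dots> = ennreal (k * measure P (C - R))" using R C by (intro const) auto
    finally show ?thesis using k0 by (simp add: Q.emeasure_eq_measure)
  qed
  have lo: "k * measure P (R - C) \<le> measure Q (R - C)"
  proof -
    have "ennreal (k * measure P (R - C)) = (\<integral>\<^sup>+x. ennreal k * indicator (R - C) x \<partial>P)"
      using R C by (intro const[symmetric]) auto
    also have "\<dots> \<le> emeasure Q (R - C)"
      unfolding emQ[OF sets.Diff[OF R C]] using kR
      by (intro nn_integral_mono) (auto split: split_indicator intro!: ennreal_leI)
    finally show ?thesis by (simp add: Q.emeasure_eq_measure)
  qed
  have "measure P (R - C) \<le> measure P (C - R)"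
  proof (cases "k = 0")
    case False
    then show ?thesis using up lo Qeq k0 by (smt (verit) mult_le_cancel_left_pos)
  next
    \<comment> \<open>Nothing can be cancelled here. Instead \<open>up\<close> forces
      \<open>Q (C - R)\<close>, and so \<open>Q (R - C)\<close>, to be zero. Then \<open>h\<close>
      vanishes almost everywhere on \<open>R - C\<close>, which \<open>pos\<close> allows only if
      \<open>R - C\<close> is \<open>P\<close>-null.\<close>
    case True
    then have "measure Q (R - C) = 0" using up Qeq by (simp add: measure_le_0_iff)
    then have "(\<integral>\<^sup>+x. ennreal (h x) * indicator (R - C) x \<partial>P) = 0"
      using emQ[OF sets.Diff[OF R C]] by (simp add: Q.emeasure_eq_measure)
    then have "AE x in P. ennreal (h x) * indicator (R - C) x = 0"
      using hm R C by (subst (asm) nn_integral_0_iff_AE) auto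
    with pos have "AE x in P. x \<notin> R - C"
      by eventually_elim (auto split: split_indicator_asm)
    then have "measure P (R - C) = 0"
      using R C by (subst (asm) AE_iff_measurable[of "R - C"]) (auto simp: measure_def RP[THEN subsetD])
    then show ?thesis by simp
  qed
  then show ?thesis
    using split[OF fin, of R C] split[OF fin, of C R] R C by (simp add: Int_commute)
qed

text \<open>The content of a strict superlevel set is antitone in the threshold, hence Borel in it;
  the region is a sublevel set of this function composed with the ratio.\<close>

lemma relative_surprise_region_sets:
  assumes "finite_measure Q"
    and [measurable]: "(\<lambda>\<tau>. q \<tau> / p \<tau>) \<in> borel_measurable Q"
  shows "relative_surprise_region Q p q \<gamma> \<in> sets Q"
proof -
  interpret finite_measure Q by fact
  define G where "G t = measure Q {\<tau> \<in> space Q. q \<tau> / p \<tau> > t}" for t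
  have "mono (\<lambda>t. - G t)"
    unfolding G_def by (intro monoI) (auto intro!: finite_measure_mono)
  then have "(\<lambda>t. - G t) \<in> borel_measurable borel" by (rule borel_measurable_mono)
  then have [measurable]: "G \<in> borel_measurable borel" by simp
  have "relative_surprise_region Q p q \<gamma> = {\<tau> \<in> space Q. G (q \<tau> / p \<tau>) \<le> \<gamma>}"
    unfolding relative_surprise_region_def G_def ..
  also have "\<dots> \<in> sets Q" by measurable
  finally show ?thesis .
qed

text \<open>Raising the ratio shrinks the strict superlevel set, so a point with a larger ratio than
  a member of the region also meets the bound \<open>\<gamma>\<close>.\<close>

lemma relative_surprise_region_upper:
  assumes "finite_measure Q"
    and [measurable]: "(\<lambda>\<tau>. q \<tau> / p \<tau>) \<in> borel_measurable Q"
    and a: "a \<in> relative_surprise_region Q p q \<gamma>"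
    and b: "b \<in> space Q - relative_surprise_region Q p q \<gamma>"
  shows "q b / p b \<le> q a / p a"
proof (rule ccontr)
  interpret finite_measure Q by fact
  assume "\<not> q b / p b \<le> q a / p a"
  then have "measure Q {\<tau> \<in> space Q. q \<tau> / p \<tau> > q b / p b}
      \<le> measure Q {\<tau> \<in> space Q. q \<tau> / p \<tau> > q a / p a}"
    by (intro finite_measure_mono) auto
  then show False using a b unfolding relative_surprise_region_def by auto
qed

text \<open>The odds t / (1 - t) increase with t on [0, 1). The posterior odds agree and are finite,
  so the smaller prior odds, which are positive, give the larger quotient.\<close>

lemma bayes_factor_antimono:
  assumes "prob_space Q" "measure Q C = measure Q R" "measure Q R \<noteq> 1"
    and "0 < measure P R" "measure P C < 1" "measure P R \<le> measure P C"
  shows "bayes_factor P Q C \<le> bayes_factor P Q R"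
proof -
  have "measure Q R < 1" using assms(1,3) prob_space.prob_le_1[of Q R] by simp
  moreover have "measure P R / (1 - measure P R) \<le> measure P C / (1 - measure P C)"
    using assms by (intro frac_le) auto
  moreover have "0 < measure P R / (1 - measure P R)" using assms by simp
  ultimately have "measure Q R / (1 - measure Q R) / (measure P C / (1 - measure P C))
      \<le> measure Q R / (1 - measure Q R) / (measure P R / (1 - measure P R))"
    by (intro divide_left_mono mult_pos_pos) auto
  then show ?thesis unfolding bayes_factor_def using assms(2,3) by simp
qed

theorem theorem7:
  fixes prior :: "'t measure" and \<mu> :: "'x measure" and f :: "'t \<Rightarrow> 'x \<Rightarrow> real"
    and post :: "'x \<Rightarrow> 't measure" and \<nu> :: "'p measure" and \<Upsilon> :: "'t \<Rightarrow> 'p"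
    and d :: "'p \<Rightarrow> real" and dpost :: "'x \<Rightarrow> 'p \<Rightarrow> real"
    and \<gamma> :: real and x :: 'x and P Q :: "'p measure" and R :: "'p set"
  assumes "bayesian_model prior \<mu> f post \<nu> \<Upsilon> d dpost"
    and "0 \<le> \<gamma>" and "\<gamma> \<le> 1" and "x \<in> space \<mu>"
    and "P = distr prior \<nu> \<Upsilon>"
    and "Q = distr (post x) \<nu> \<Upsilon>"
    and "R = relative_surprise_region Q d (dpost x) \<gamma>"
  shows "R \<in> sets \<nu> \<and>
    (\<forall>C\<in>sets \<nu>. measure Q C = measure Q R \<longrightarrow>
       0 < measure P C \<longrightarrow> measure P C < 1 \<longrightarrow>
       0 < measure P R \<longrightarrow> measure P R < 1 \<longrightarrow>
       bayes_factor P Q C \<le> bayes_factor P Q R) \<and>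
    ((\<gamma> = 1 \<longrightarrow> (AE \<tau> in P. 0 < dpost x \<tau>)) \<longrightarrow>
     (\<forall>C\<in>sets \<nu>. measure Q C = measure Q R \<longrightarrow>
       0 < measure P C \<longrightarrow> 0 < measure P R \<longrightarrow>
       relative_belief_ratio P Q C \<le> relative_belief_ratio P Q R))"
proof -
  interpret bayesian_model prior \<mu> f post \<nu> \<Upsilon> d dpost by fact
  note x = \<open>x \<in> space \<mu>\<close>
  define h where "h \<tau> = dpost x \<tau> / d \<tau>" for \<tau>
  have "post x \<in> space (prob_algebra prior)"
    using posterior x unfolding is_posterior_def by (auto dest: measurable_space)
  then have post: "prob_space (post x)" "sets (post x) = sets prior"
    by (auto simp: space_prob_algebra)
  have PP: "prob_space P"
    unfolding assms(5) by (intro prob_space.prob_space_distr prior_prob \<Upsilon>_measurable)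
  have "\<Upsilon> \<in> post x \<rightarrow>\<^sub>M \<nu>"
    using \<Upsilon>_measurable measurable_cong_sets[OF post(2) refl, of \<nu>] by simp
  then have QQ: "prob_space Q"
    unfolding assms(6) by (intro prob_space.prob_space_distr post)
  interpret P: prob_space P by (rule PP)
  interpret Q: prob_space Q by (rule QQ)
  have sets: "sets P = sets \<nu>" "sets Q = sets \<nu>" and spaces: "space P = space \<nu>" "space Q = space \<nu>"
    by (auto simp: assms(5,6))
  have hm: "h \<in> borel_measurable \<nu>"
    unfolding h_def using dpost_measurable[OF x] d_measurable by measurable
  have hmP: "h \<in> borel_measurable P" and hmQ: "h \<in> borel_measurable Q"
    using hm by (simp_all cong: measurable_cong_sets add: sets)
  have h0: "0 \<le> h \<tau>" if "\<tau> \<in> space \<nu>" for \<tau>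
    unfolding h_def using dpost_nonneg[OF x that] d_pos[OF that] by simp
  have hpos: "0 < h \<tau> \<longleftrightarrow> 0 < dpost x \<tau>" if "\<tau> \<in> space \<nu>" for \<tau>
    unfolding h_def using d_pos[OF that] by (simp add: zero_less_divide_iff)
  \<comment> \<open>Chain rule for densities: \<open>P\<close> has density \<open>d\<close> with
    respect to \<open>\<nu>\<close>, and \<open>d * h\<close> is \<open>dpost x\<close> because
    \<open>d\<close> is positive.\<close>
  have Qdens: "Q = density P (\<lambda>\<tau>. ennreal (h \<tau>))"
  proof -
    have "density P (\<lambda>\<tau>. ennreal (h \<tau>)) = density \<nu> (\<lambda>\<tau>. ennreal (d \<tau>) * ennreal (h \<tau>))"
      unfolding assms(5) d_density using hm d_measurable by (intro density_density_eq) auto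
    also have "\<dots> = density \<nu> (\<lambda>\<tau>. ennreal (dpost x \<tau>))"
    proof (rule density_cong)
      show "AE \<tau> in \<nu>. ennreal (d \<tau>) * ennreal (h \<tau>) = ennreal (dpost x \<tau>)"
      proof (rule AE_I2)
        fix \<tau> assume \<tau>: "\<tau> \<in> space \<nu>"
        show "ennreal (d \<tau>) * ennreal (h \<tau>) = ennreal (dpost x \<tau>)"
          using d_pos[OF \<tau>] h0[OF \<tau>] by (simp add: ennreal_mult[symmetric] h_def)
      qed
    qed (use hm d_measurable dpost_measurable[OF x] in auto)
    finally show ?thesis using dpost_density[OF x] assms(6) by simp
  qed
  have h_frac: "(\<lambda>\<tau>. dpost x \<tau> / d \<tau>) \<in> borel_measurable Q"
    using hmQ unfolding h_def .
  have R: "R \<in> sets \<nu>"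
    using relative_surprise_region_sets[OF Q.finite_measure_axioms h_frac] sets assms(7) by simp
  have upper: "h b \<le> h a" if "a \<in> R" "b \<in> space \<nu> - R" for a b
    using relative_surprise_region_upper[OF Q.finite_measure_axioms h_frac] that
    unfolding assms(7) h_def spaces .
  have Rsp: "R \<subseteq> space \<nu>" using R sets.sets_into_space by auto
  \<comment> \<open>A measure does not charge the zero set of its own density.\<close>
  have Qpos: "AE \<tau> in Q. 0 < h \<tau>"
    unfolding Qdens using hmP by (subst AE_density) auto
  have comparison: "measure P R \<le> measure P C"
    if "C \<in> sets \<nu>" "measure Q C = measure Q R" "AE \<tau> in P. \<tau> \<in> R \<longrightarrow> 0 < h \<tau>" for C
    using measure_le_of_density_upper_set[OF P.finite_measure_axioms hmP _ Qdens
        Q.finite_measure_axioms, of R C] that h0 upper R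
    by (simp add: sets spaces)
  \<comment> \<open>By \<open>upper\<close>, no point off \<open>R\<close> has a ratio above
    \<open>h a\<close>, so \<open>R\<close> contains all points with positive \<open>h\<close>, a
    set of full posterior content by \<open>Qpos\<close>.\<close>
  have full: "measure Q R = 1" if a: "a \<in> R" "\<not> 0 < h a" for a
  proof -
    have "AE \<tau> in Q. \<tau> \<in> R"
      using Qpos AE_space
    proof eventually_elim
      case (elim \<tau>)
      then show ?case using upper[OF a(1), of \<tau>] a(2) spaces by fastforce
    qed
    then show ?thesis using R sets by (subst Q.prob_eq_1) auto
  qed
  have "bayes_factor P Q C \<le> bayes_factor P Q R"
    if C: "C \<in> sets \<nu>" "measure Q C = measure Q R" "measure P C < 1" "0 < measure P R" for C
  \<comment> \<open>With full posterior content both Bayes factors are infinite. Otherwise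
    \<open>full\<close> shows that \<open>h\<close> is positive everywhere on \<open>R\<close>, so
    \<open>comparison\<close> applies.\<close>
  proof (cases "measure Q R = 1")
    case True
    then show ?thesis by (simp add: bayes_factor_def)
  next
    case False
    then have "measure P R \<le> measure P C"
      using full C by (intro comparison) auto
    then show ?thesis using C False QQ by (intro bayes_factor_antimono) auto
  qed
  moreover have "relative_belief_ratio P Q C \<le> relative_belief_ratio P Q R"
    if ae: "\<gamma> = 1 \<longrightarrow> (AE \<tau> in P. 0 < dpost x \<tau>)"
      and C: "C \<in> sets \<nu>" "measure Q C = measure Q R" "0 < measure P R" for C
  proof -
    have "AE \<tau> in P. \<tau> \<in> R \<longrightarrow> 0 < h \<tau>"
    \<comment> \<open>For \<open>\<gamma> = 1\<close> positivity is the extra hypothesis. For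
      smaller \<open>\<gamma>\<close> it is automatic: if \<open>h\<close> vanished at a point of
      \<open>R\<close>, its superlevel set there would be \<open>{0 < h}\<close>, whose content 1
      exceeds \<open>\<gamma>\<close>.\<close>
    proof (cases "\<gamma> = 1")
      case True
      with ae have "AE \<tau> in P. 0 < dpost x \<tau>" by simp
      then show ?thesis using AE_space
        by eventually_elim (simp add: hpos spaces)
    next
      case False
      have "0 < h a" if a: "a \<in> R" for a
      proof (rule ccontr)
        assume "\<not> 0 < h a"
        then have "h a = 0" using h0[of a] a Rsp by force
        then have "measure Q {\<tau> \<in> space Q. 0 < h \<tau>} \<le> \<gamma>"
          using a by (simp add: assms(7) relative_surprise_region_def flip: h_def)
        moreover have "measure Q {\<tau> \<in> space Q. 0 < h \<tau>} = 1"
          using Qpos hmQ by (subst Q.prob_Collect_eq_1) auto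
        ultimately show False using False \<open>\<gamma> \<le> 1\<close> by simp
      qed
      then show ?thesis by simp
    qed
    then have "measure P R \<le> measure P C" using C by (intro comparison) auto
    then show ?thesis
      unfolding relative_belief_ratio_def C(2) using C(3) by (intro divide_left_mono) auto
  qed
  ultimately show ?thesis using R by blast
qed

end
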